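(* (Necessary and Sufficient Condition for Rank Reversal.) The following condition yields rank reversal between treatments $j$ and $k$: $$\mathbb{E}[\tau_j(\mathbf{X})] + \mathrm{Cov}(\tau_j(\mathbf{X}), \gamma_j(\mathbf{X})) < \mathbb{E}[\tau_k(\mathbf{X})] + \mathrm{Cov}(\tau_k(\mathbf{X}), \gamma_k(\mathbf{X})).$$
   Context: There are several binary treatments and a control. $\mathbf{X}$ is a random vector of pre-treatment covariates in $\mathbb{R}^d$, and $Y(g)$, $Y(0)$ denote the potential outcomes under treatment $g$ and under control. Selection on observables (unconfoundedness and overlap) is assumed. For each treatment $g$, let $W_g \in \{0,1\}$ indicate receipt of treatment $g$, with propensity score $p_g(\mathbf{X}) = \mathbb{E}[W_g \mid \mathbf{X}]$, and let $\tau_g(\mathbf{X}) = \mathbb{E}[Y(g) - Y(0) \mid \mathbf{X}]$ be the conditional treatment effect of $g$ relative to control. The normalized regression weights are $$\gamma_g(\mathbf{X}) = \frac{\mathbb{V}[W_g \mid \mathbf{X}]}{\mathbb{E}[\mathbb{V}[W_g \mid \mathbf{X}]]} = \frac{p_g(\mathbf{X})(1-p_g(\mathbf{X}))}{\mathbb{E}[p_g(\mathbf{X})(1-p_g(\mathbf{X}))]}.$$ Define $\mathrm{ATE}_g = \mathbb{E}[\tau_g(\mathbf{X})]$ (average treatment effect), $\mathrm{WATE}_g = \mathbb{E}[\gamma_g(\mathbf{X})\tau_g(\mathbf{X})]$ (weighted average treatment effect), and $\mathrm{Cov}(A,B) = \mathbb{E}[AB] - \mathbb{E}[A]\mathbb{E}[B]$.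 A rank reversal between treatments $j$ and $k$ means that $\mathrm{ATE}_j > \mathrm{ATE}_k$ but $\mathrm{WATE}_j < \mathrm{WATE}_k$.
   Formalization: The condition is proved equivalent to rank reversal under the added assumption ATE_j > ATE_k; without it the condition does not yield rank reversal (constant propensities, τ_j = 0, τ_k = 1). *)

theory Defs
  imports "HOL-Probability.Probability"
begin

text \<open>
  Functions of the covariates such as \<open>p\<^sub>g(X)\<close>, \<open>\<gamma>\<^sub>g(X)\<close>, \<open>\<tau>\<^sub>g(X)\<close> are random variables
  on the underlying probability space: conditional expectations given the sigma-algebra generated
  by \<open>X\<close>. All expectations below are independent of the version of the conditional expectation.
\<close>

definition sigma_gen :: "'a measure \<Rightarrow> ('a \<Rightarrow> real ^ 'd) \<Rightarrow> 'a measure"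
  where "sigma_gen M X = vimage_algebra (space M) X borel"

definition cond_expect :: "'a measure \<Rightarrow> ('a \<Rightarrow> real ^ 'd) \<Rightarrow> ('a \<Rightarrow> real) \<Rightarrow> 'a \<Rightarrow> real"
  where "cond_expect M X Z = real_cond_exp M (sigma_gen M X) Z"

definition cond_variance :: "'a measure \<Rightarrow> ('a \<Rightarrow> real ^ 'd) \<Rightarrow> ('a \<Rightarrow> real) \<Rightarrow> 'a \<Rightarrow> real"
  where "cond_variance M X Z = cond_expect M X (\<lambda>\<omega>. (Z \<omega> - cond_expect M X Z \<omega>)\<^sup>2)"

definition cond_indep ::
    "'a measure \<Rightarrow> ('a \<Rightarrow> real ^ 'd) \<Rightarrow> 'b measure \<Rightarrow> ('a \<Rightarrow> 'b) \<Rightarrow> 'c measure \<Rightarrow> ('a \<Rightarrow> 'c) \<Rightarrow> bool"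
  where "cond_indep M X S U T V \<longleftrightarrow>
    (\<forall>A\<in>sets S. \<forall>B\<in>sets T. AE \<omega> in M.
       cond_expect M X (\<lambda>\<omega>. indicator A (U \<omega>) * indicator B (V \<omega>)) \<omega> =
       cond_expect M X (\<lambda>\<omega>. indicator A (U \<omega>)) \<omega> * cond_expect M X (\<lambda>\<omega>. indicator B (V \<omega>)) \<omega>)"

definition covar :: "'a measure \<Rightarrow> ('a \<Rightarrow> real) \<Rightarrow> ('a \<Rightarrow> real) \<Rightarrow> real"
  where "covar M A B =
    integral\<^sup>L M (\<lambda>\<omega>. A \<omega> * B \<omega>) - integral\<^sup>L M A * integral\<^sup>L M B"

text \<open>
  In the following, \<open>W\<close> is the indicator of one treatment, \<open>Y1\<close> the potential outcome under that
  treatment and \<open>Y0\<close> the potential outcome under control.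
\<close>

definition propensity :: "'a measure \<Rightarrow> ('a \<Rightarrow> real ^ 'd) \<Rightarrow> ('a \<Rightarrow> real) \<Rightarrow> 'a \<Rightarrow> real"
  where "propensity M X W = cond_expect M X W"

definition unconfounded ::
    "'a measure \<Rightarrow> ('a \<Rightarrow> real ^ 'd) \<Rightarrow> ('a \<Rightarrow> real) \<Rightarrow> ('a \<Rightarrow> real) \<Rightarrow> ('a \<Rightarrow> real) \<Rightarrow> bool"
  where "unconfounded M X W Y1 Y0 \<longleftrightarrow>
    cond_indep M X (borel \<Otimes>\<^sub>M borel) (\<lambda>\<omega>. (Y1 \<omega>, Y0 \<omega>)) borel W"

definition overlap :: "'a measure \<Rightarrow> ('a \<Rightarrow> real ^ 'd) \<Rightarrow> ('a \<Rightarrow> real) \<Rightarrow> bool"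
  where "overlap M X W \<longleftrightarrow> (AE \<omega> in M. 0 < propensity M X W \<omega> \<and> propensity M X W \<omega> < 1)"

definition reg_weight :: "'a measure \<Rightarrow> ('a \<Rightarrow> real ^ 'd) \<Rightarrow> ('a \<Rightarrow> real) \<Rightarrow> 'a \<Rightarrow> real"
  where "reg_weight M X W = (\<lambda>\<omega>. cond_variance M X W \<omega> / integral\<^sup>L M (cond_variance M X W))"

definition cond_effect ::
    "'a measure \<Rightarrow> ('a \<Rightarrow> real ^ 'd) \<Rightarrow> ('a \<Rightarrow> real) \<Rightarrow> ('a \<Rightarrow> real) \<Rightarrow> 'a \<Rightarrow> real"
  where "cond_effect M X Y1 Y0 = cond_expect M X (\<lambda>\<omega>. Y1 \<omega> - Y0 \<omega>)"

definition ATE ::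
    "'a measure \<Rightarrow> ('a \<Rightarrow> real ^ 'd) \<Rightarrow> ('a \<Rightarrow> real) \<Rightarrow> ('a \<Rightarrow> real) \<Rightarrow> real"
  where "ATE M X Y1 Y0 = integral\<^sup>L M (cond_effect M X Y1 Y0)"

definition WATE ::
    "'a measure \<Rightarrow> ('a \<Rightarrow> real ^ 'd) \<Rightarrow> ('a \<Rightarrow> real) \<Rightarrow> ('a \<Rightarrow> real) \<Rightarrow> ('a \<Rightarrow> real) \<Rightarrow> real"
  where "WATE M X W Y1 Y0 =
    integral\<^sup>L M (\<lambda>\<omega>. reg_weight M X W \<omega> * cond_effect M X Y1 Y0 \<omega>)"

definition rank_reversal ::
    "'a measure \<Rightarrow> ('a \<Rightarrow> real ^ 'd) \<Rightarrow> ('g \<Rightarrow> 'a \<Rightarrow> real) \<Rightarrow> ('g \<Rightarrow> 'a \<Rightarrow> real) \<Rightarrow>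
     ('a \<Rightarrow> real) \<Rightarrow> 'g \<Rightarrow> 'g \<Rightarrow> bool"
  where "rank_reversal M X W Y Y0 j k \<longleftrightarrow>
    ATE M X (Y j) Y0 > ATE M X (Y k) Y0 \<and>
    WATE M X (W j) (Y j) Y0 < WATE M X (W k) (Y k) Y0"

text \<open>
  For a binary treatment indicator the conditional variance is \<open>p(X)(1 - p(X))\<close>, which gives the
  propensity-score form of the weights.
\<close>

lemma cond_variance_binary:
  fixes X :: "'a \<Rightarrow> real ^ 'd"
  assumes "prob_space M" and X: "X \<in> borel_measurable M" and W: "W \<in> borel_measurable M"
    and bin: "\<And>\<omega>. \<omega> \<in> space M \<Longrightarrow> W \<omega> \<in> {0, 1}"
  shows "AE \<omega> in M. cond_variance M X W \<omega> = propensity M X W \<omega> * (1 - propensity M X W \<omega>)"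
proof -
  interpret prob_space M by fact
  let ?F = "sigma_gen M X"
  have sub: "subalgebra M ?F"
    unfolding subalgebra_def sigma_gen_def using X
    by (auto simp: sets_vimage_algebra2 measurable_def)
  interpret finite_measure_subalgebra M ?F
    by unfold_locales (rule sub)
  define p where "p = real_cond_exp M ?F W"
  have pF [measurable]: "p \<in> borel_measurable ?F" unfolding p_def by simp
  have pM [measurable]: "p \<in> borel_measurable M" unfolding p_def by simp
  note W [measurable]
  have iW: "integrable M W"
    by (rule integrable_const_bound[where B = 1]) (use bin in \<open>force intro: AE_I2\<close>)+
  have "AE \<omega> in M. p \<omega> \<ge> 0"
    unfolding p_def by (rule real_cond_exp_ge_c) (use bin iW in \<open>force intro: AE_I2\<close>)+
  moreover have "AE \<omega> in M. p \<omega> \<le> 1"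
    unfolding p_def by (rule real_cond_exp_le_c) (use bin iW in \<open>force intro: AE_I2\<close>)+
  ultimately have p01: "AE \<omega> in M. 0 \<le> p \<omega> \<and> p \<omega> \<le> 1" by auto
  have ipp: "integrable M (\<lambda>\<omega>. p \<omega> * p \<omega>)"
  proof (rule integrable_const_bound[where B = 1])
    show "AE \<omega> in M. norm (p \<omega> * p \<omega>) \<le> 1"
      using p01 by eventually_elim (simp add: abs_mult mult_le_one)
  qed measurable
  have qb: "AE \<omega> in M. \<bar>1 - 2 * p \<omega>\<bar> \<le> 1" using p01 by eventually_elim auto
  have iqW: "integrable M (\<lambda>\<omega>. (1 - 2 * p \<omega>) * W \<omega>)"
  proof (rule integrable_const_bound[where B = 1])
    show "AE \<omega> in M. norm ((1 - 2 * p \<omega>) * W \<omega>) \<le> 1"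
      using qb AE_space by eventually_elim (use bin in force)
  qed measurable
  have eq: "(W \<omega> - p \<omega>)\<^sup>2 = (1 - 2 * p \<omega>) * W \<omega> + p \<omega> * p \<omega>" if "\<omega> \<in> space M" for \<omega>
    using bin[OF that] by (auto simp: power2_eq_square algebra_simps)
  have "AE \<omega> in M. real_cond_exp M ?F (\<lambda>\<omega>. (W \<omega> - p \<omega>)\<^sup>2) \<omega> =
      real_cond_exp M ?F (\<lambda>\<omega>. (1 - 2 * p \<omega>) * W \<omega> + p \<omega> * p \<omega>) \<omega>"
    by (rule real_cond_exp_cong) (use eq in \<open>auto intro!: AE_I2\<close>)
  moreover have "AE \<omega> in M.
      real_cond_exp M ?F (\<lambda>\<omega>. (1 - 2 * p \<omega>) * W \<omega> + p \<omega> * p \<omega>) \<omega> =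
      real_cond_exp M ?F (\<lambda>\<omega>. (1 - 2 * p \<omega>) * W \<omega>) \<omega> + real_cond_exp M ?F (\<lambda>\<omega>. p \<omega> * p \<omega>) \<omega>"
    by (rule real_cond_exp_add[OF iqW ipp])
  moreover have "AE \<omega> in M. real_cond_exp M ?F (\<lambda>\<omega>. (1 - 2 * p \<omega>) * W \<omega>) \<omega> = (1 - 2 * p \<omega>) * p \<omega>"
    unfolding p_def[symmetric]
    using real_cond_exp_mult[OF _ _ iqW] by (simp add: p_def[symmetric])
  moreover have "AE \<omega> in M. real_cond_exp M ?F (\<lambda>\<omega>. p \<omega> * p \<omega>) \<omega> = p \<omega> * p \<omega>"
    by (rule real_cond_exp_F_meas[OF ipp]) measurable
  ultimately have "AE \<omega> in M. real_cond_exp M ?F (\<lambda>\<omega>. (W \<omega> - p \<omega>)\<^sup>2) \<omega> = p \<omega> * (1 - p \<omega>)"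
    by eventually_elim (simp add: algebra_simps)
  then show ?thesis
    unfolding cond_variance_def propensity_def cond_expect_def p_def .
qed

lemma reg_weight_binary:
  fixes X :: "'a \<Rightarrow> real ^ 'd"
  assumes "prob_space M" and "X \<in> borel_measurable M" and "W \<in> borel_measurable M"
    and "\<And>\<omega>. \<omega> \<in> space M \<Longrightarrow> W \<omega> \<in> {0, 1}"
  shows "AE \<omega> in M. reg_weight M X W \<omega> =
    propensity M X W \<omega> * (1 - propensity M X W \<omega>) /
    integral\<^sup>L M (\<lambda>\<omega>. propensity M X W \<omega> * (1 - propensity M X W \<omega>))"
proof -
  have ae: "AE \<omega> in M. cond_variance M X W \<omega> = propensity M X W \<omega> * (1 - propensity M X W \<omega>)"
    by (rule cond_variance_binary[OF assms])
  have "integral\<^sup>L M (cond_variance M X W) =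
      integral\<^sup>L M (\<lambda>\<omega>. propensity M X W \<omega> * (1 - propensity M X W \<omega>))"
    by (rule integral_cong_AE[OF _ _ ae]) (simp_all add: cond_variance_def propensity_def cond_expect_def)
  with ae show ?thesis unfolding reg_weight_def by auto
qed

end

theory Submission
  imports Defs
begin

text \<open>
  Under overlap the mean conditional variance is strictly positive, so the normalized weights have
  mean one; hence \<open>WATE = ATE + Cov(\<tau>, \<gamma>)\<close>, and the stated inequality is the second half of
  a rank reversal.
\<close>

text \<open>For a binary indicator the conditional variance is p(1 - p) almost everywhere, and
  overlap keeps both factors strictly positive. This makes the normalization in
  \<open>reg_weight\<close> a genuine division.\<close>

lemma integral_cond_variance_pos:
  fixes X :: "'a \<Rightarrow> real ^ 'd"
  assumes "prob_space M" and "X \<in> borel_measurable M" and "W \<in> borel_measurable M"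
    and "\<And>\<omega>. \<omega> \<in> space M \<Longrightarrow> W \<omega> \<in> {0, 1}" and "overlap M X W"
  shows "0 < integral\<^sup>L M (cond_variance M X W)"
proof -
  interpret prob_space M by fact
  have [measurable]: "cond_variance M X W \<in> borel_measurable M"
    by (simp add: cond_variance_def cond_expect_def)
  \<comment> \<open>The upper bound 1 gives integrability; the strict lower bound gives positivity
    of the mean.\<close>
  have var01: "AE \<omega> in M. 0 < cond_variance M X W \<omega> \<and> cond_variance M X W \<omega> \<le> 1"
  proof -
    have "AE \<omega> in M. cond_variance M X W \<omega> = propensity M X W \<omega> * (1 - propensity M X W \<omega>)"
      by (rule cond_variance_binary) (fact assms)+
    then show ?thesis
      using assms(5)[unfolded overlap_def] by eventually_elim (simp add: mult_le_one)
  qed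
  have int: "integrable M (cond_variance M X W)"
    by (rule integrable_const_bound[where B = 1]) (use var01 in auto)
  \<comment> \<open>An almost everywhere strict inequality survives integration because the space
    has mass 1 and so is not null.\<close>
  have "integral\<^sup>L M (\<lambda>_. 0) < integral\<^sup>L M (cond_variance M X W)"
    by (rule integral_less_AE_space) (use var01 int emeasure_space_1 in auto)
  then show ?thesis by simp
qed

text \<open>A zero denominator would give mean 0 instead, since x / 0 = 0; positivity rules this
  out.\<close>

lemma integral_reg_weight:
  fixes X :: "'a \<Rightarrow> real ^ 'd"
  assumes "prob_space M" and "X \<in> borel_measurable M" and "W \<in> borel_measurable M"
    and "\<And>\<omega>. \<omega> \<in> space M \<Longrightarrow> W \<omega> \<in> {0, 1}" and "overlap M X W"
  shows "integral\<^sup>L M (reg_weight M X W) = 1"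
  using integral_cond_variance_pos[OF assms] by (simp add: reg_weight_def)

text \<open>As the weights have mean one, the product of means inside \<open>covar\<close> is the
  mean effect and cancels the added one. The integral of the product stands on both sides, so the
  identity is pure algebra, even where that integral takes the default value 0.\<close>

lemma WATE_eq_ATE_plus_covar:
  fixes X :: "'a \<Rightarrow> real ^ 'd"
  assumes "prob_space M" and "X \<in> borel_measurable M" and "W \<in> borel_measurable M"
    and "\<And>\<omega>. \<omega> \<in> space M \<Longrightarrow> W \<omega> \<in> {0, 1}" and "overlap M X W"
  shows "WATE M X W Y1 Y0 = integral\<^sup>L M (cond_effect M X Y1 Y0)
    + covar M (cond_effect M X Y1 Y0) (reg_weight M X W)"
  by (simp add: WATE_def covar_def integral_reg_weight[OF assms] mult.commute)

theorem proposition3p4: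
  fixes M :: "'a measure" and X :: "'a \<Rightarrow> real ^ 'd"
    and W Y :: "'g \<Rightarrow> 'a \<Rightarrow> real" and Y0 :: "'a \<Rightarrow> real" and j k :: 'g
  assumes "prob_space M"
    and "X \<in> borel_measurable M"
    and "\<And>g. W g \<in> borel_measurable M"
    and "\<And>g \<omega>. \<omega> \<in> space M \<Longrightarrow> W g \<omega> \<in> {0, 1}"
    and "\<And>g. Y g \<in> borel_measurable M"
    and "Y0 \<in> borel_measurable M"
    and "\<And>g. integrable M (\<lambda>\<omega>. Y g \<omega> - Y0 \<omega>)"
    and "\<And>g. unconfounded M X (W g) (Y g) Y0"
    and "\<And>g. overlap M X (W g)"
    and "ATE M X (Y j) Y0 > ATE M X (Y k) Y0"
  shows "rank_reversal M X W Y Y0 j k \<longleftrightarrow>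
    integral\<^sup>L M (cond_effect M X (Y j) Y0)
      + covar M (cond_effect M X (Y j) Y0) (reg_weight M X (W j))
    < integral\<^sup>L M (cond_effect M X (Y k) Y0)
      + covar M (cond_effect M X (Y k) Y0) (reg_weight M X (W k))"
  \<comment> \<open>The assumed ATE ordering settles the first conjunct of
    \<open>rank_reversal\<close>, so the WATE inequality alone is equivalent to a reversal.\<close>
  using assms(10)
  by (simp add: rank_reversal_def WATE_eq_ATE_plus_covar[OF assms(1,2,3,4,9)])

end
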